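(* Let $G=(V,E)$ be a finite simple graph with nonnegative real vertex weights $w$, and suppose $G$ is a unique independence weighted graph with unique $\alpha$-set $I$. Then there exists $\epsilon>0$ such that for every weight function $w':V\to\mathbb{R}$ with $w(x)-\epsilon<w'(x)<w(x)+\epsilon$ for all $x\in V$, the graph $G$ with weights $w'$ is a unique independence weighted graph and $I$ is its unique $\alpha$-set.
   Context: For a weight function $u$ and $S\subseteq V$, $u(S)=\sum_{v\in S}u(v)$. An independent set is a set of pairwise nonadjacent vertices; an $\alpha$-set with respect to $u$ is an independent set of maximum $u$-weight, and the weighted graph is a unique independence weighted graph if it has exactly one $\alpha$-set. *)

theory Defs
  imports Complex_Main "HOL-Library.Ramsey"
begin

definition finite_simple_graph :: "'a set \<Rightarrow> 'a set set \<Rightarrow> bool" where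
  "finite_simple_graph V E \<longleftrightarrow> finite V \<and> E \<subseteq> nsets V 2"

(* Weight functions are total; only their values on V matter. They are not required to be
   nonnegative here, because perturbed weights may take negative values. *)

definition independent_set :: "'a set \<Rightarrow> 'a set set \<Rightarrow> 'a set \<Rightarrow> bool" where
  "independent_set V E S \<longleftrightarrow> S \<subseteq> V \<and> indep S E"

definition alpha_set :: "'a set \<Rightarrow> 'a set set \<Rightarrow> ('a \<Rightarrow> real) \<Rightarrow> 'a set \<Rightarrow> bool" where
  "alpha_set V E u S \<longleftrightarrow>
     independent_set V E S \<and> (\<forall>T. independent_set V E T \<longrightarrow> sum u T \<le> sum u S)"

definition unique_independence_weighted :: "'a set \<Rightarrow> 'a set set \<Rightarrow> ('a \<Rightarrow> real) \<Rightarrow> bool" where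
  "unique_independence_weighted V E u \<longleftrightarrow> (\<exists>!S. alpha_set V E u S)"

end

theory Submission
  imports Defs
begin

text \<open>There are finitely many independent sets, so the weight of the unique maximum one exceeds
  all the others by a positive gap \<open>d\<close>. Changing each vertex weight by less than
  \<open>d / (2 * (card V + 1))\<close> changes the weight of each set by less than \<open>d / 2\<close>.\<close>

lemma finite_strict_upper_bound_gap:
  fixes f :: "'b \<Rightarrow> real"
  assumes "finite A" and "\<And>x. x \<in> A \<Longrightarrow> f x < m"
  obtains d where "d > 0" and "\<And>x. x \<in> A \<Longrightarrow> f x + d \<le> m"
proof
  \<comment> \<open>The inserted 1 keeps the set nonempty when \<open>A\<close> is empty;
    \<open>?d\<close> is then a minimum of finitely many positive numbers.\<close>
  let ?d = "Min (insert 1 ((\<lambda>x. m - f x) ` A))"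
  show "?d > 0"
    using assms by (subst Min_gr_iff) auto
  show "f x + ?d \<le> m" if "x \<in> A" for x
  proof -
    have "?d \<le> m - f x"
      using assms(1) that by (intro Min_le) auto
    then show ?thesis by simp
  qed
qed

text \<open>Triangle inequality over \<open>S\<close>. Bounding by \<open>card V\<close> instead of
  \<open>card S\<close> makes the estimate uniform, so one \<open>e\<close> serves all subsets at
  once.\<close>

lemma sum_perturbation_le:
  fixes f g :: "'b \<Rightarrow> real" and e :: real
  assumes "finite V" and "S \<subseteq> V" and "0 \<le> e"
    and "\<And>x. x \<in> V \<Longrightarrow> \<bar>g x - f x\<bar> \<le> e"
  shows "\<bar>sum g S - sum f S\<bar> \<le> card V * e"
proof -
  have "\<bar>sum g S - sum f S\<bar> \<le> (\<Sum>x\<in>S. \<bar>g x - f x\<bar>)"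
    by (simp add: sum_subtractf[symmetric])
  also have "\<dots> \<le> card S * e"
    using assms by (intro sum_bounded_above) auto
  also have "\<dots> \<le> card V * e"
    using assms by (intro mult_right_mono) (auto intro: card_mono)
  finally show ?thesis .
qed

text \<open>An independent \<open>T\<close> weighing at least as much as \<open>I\<close> would
  itself be of maximum weight, giving a second alpha-set.\<close>

lemma alpha_set_unique_strict:
  assumes "unique_independence_weighted V E u" and "alpha_set V E u I"
    and "independent_set V E T" and "T \<noteq> I"
  shows "sum u T < sum u I"
proof (rule ccontr)
  assume "\<not> ?thesis"
  with assms(2,3) have "alpha_set V E u T"
    unfolding alpha_set_def by (meson not_less order_trans)
  with assms show False
    unfolding unique_independence_weighted_def by blast
qed

text \<open>Converse direction, applied to the perturbed weights: any alpha-set weighs at least as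
  much as \<open>I\<close>, which strictness allows only for \<open>I\<close> itself.\<close>

lemma strict_max_imp_unique_alpha_set:
  assumes "independent_set V E I"
    and "\<And>T. independent_set V E T \<Longrightarrow> T \<noteq> I \<Longrightarrow> sum u T < sum u I"
  shows "unique_independence_weighted V E u \<and> alpha_set V E u I"
proof -
  have *: "alpha_set V E u I"
    using assms unfolding alpha_set_def by (metis less_imp_le order_refl)
  moreover have "S = I" if "alpha_set V E u S" for S
    using that assms unfolding alpha_set_def by (meson not_less)
  ultimately show ?thesis
    unfolding unique_independence_weighted_def by blast
qed

theorem theorem2p9:
  fixes V :: "'a set" and E :: "'a set set" and w :: "'a \<Rightarrow> real" and I :: "'a set"
  assumes "finite_simple_graph V E"
    and "\<forall>x\<in>V. 0 \<le> w x"
    and "unique_independence_weighted V E w"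
    and "alpha_set V E w I"
  shows "\<exists>\<epsilon>>0. \<forall>w' :: 'a \<Rightarrow> real.
           (\<forall>x\<in>V. w x - \<epsilon> < w' x \<and> w' x < w x + \<epsilon>) \<longrightarrow>
             unique_independence_weighted V E w' \<and> alpha_set V E w' I"
proof -
  have fin: "finite V"
    using assms(1) by (simp add: finite_simple_graph_def)
  have indep_subset: "S \<subseteq> V" if "independent_set V E S" for S
    using that by (simp add: independent_set_def)
  have I: "independent_set V E I"
    using assms(4) by (simp add: alpha_set_def)
  let ?F = "{T. independent_set V E T \<and> T \<noteq> I}"
  have "finite ?F"
    by (rule finite_subset[of _ "Pow V"]) (use fin indep_subset in auto)
  then obtain d where d: "d > 0" "\<And>T. T \<in> ?F \<Longrightarrow> sum w T + d \<le> sum w I"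
    using alpha_set_unique_strict[OF assms(3,4)]
    by (elim finite_strict_upper_bound_gap[where f = "sum w" and m = "sum w I"]) auto
  \<comment> \<open>The summand 1 keeps the denominator positive for empty \<open>V\<close> and
    makes the bound \<open>small\<close> strict.\<close>
  define \<epsilon> where "\<epsilon> = d / (2 * (real (card V) + 1))"
  have "\<epsilon> > 0"
    using d(1) by (simp add: \<epsilon>_def)
  have small: "card V * \<epsilon> < d / 2"
    using d(1) by (simp add: \<epsilon>_def field_simps)
  show ?thesis
  proof (rule exI[of _ \<epsilon>], rule conjI[OF \<open>\<epsilon> > 0\<close>], rule allI, rule impI)
    fix w' :: "'a \<Rightarrow> real"
    assume "\<forall>x\<in>V. w x - \<epsilon> < w' x \<and> w' x < w x + \<epsilon>"
    then have "\<bar>w' x - w x\<bar> \<le> \<epsilon>" if "x \<in> V" for x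
      using that by fastforce
    \<comment> \<open>The vertexwise bound is used only in its weak form; strictness comes from
      \<open>small\<close>.\<close>
    then have close: "\<bar>sum w' S - sum w S\<bar> < d / 2" if "independent_set V E S" for S
      using sum_perturbation_le[OF fin indep_subset[OF that]] \<open>\<epsilon> > 0\<close> small
      by (meson less_imp_le order_le_less_trans)
    show "unique_independence_weighted V E w' \<and> alpha_set V E w' I"
    proof (rule strict_max_imp_unique_alpha_set[OF I])
      fix T
      assume T: "independent_set V E T" "T \<noteq> I"
      then have "sum w T + d \<le> sum w I"
        using d(2) by simp
      \<comment> \<open>\<open>T\<close> gains less than \<open>d / 2\<close> and \<open>I\<close>
        loses less than \<open>d / 2\<close>, so the gap \<open>d\<close> cannot close.\<close>
      then show "sum w' T < sum w' I"
        using close[OF T(1)] close[OF I] by linarith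
    qed
  qed
qed

end
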